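(* Let $p,q\in[2,\infty]$ with $\frac{1}{p}+\frac{1}{q}<1$, and let $a,b>0$ be real numbers. The following assertions are equivalent: (a) There is a constant $C_{p,q,a,b}\geq 1$ such that $$\left(\sum_{i=1}^{n}\left(\sum_{j=1}^{n}|U(e_{i},e_{j})|^{a}\right)^{\frac{1}{a}\cdot b}\right)^{\frac{1}{b}}\leq C_{p,q,a,b}\|U\|$$ for all bilinear operators $U\colon\ell_{p}^{n}\times\ell_{q}^{n}\to\mathbb{K}$ and all positive integers $n$. (b) The exponents $a,b$ satisfy $(a,b)\in\left[\frac{q}{q-1},\infty\right)\times\left[\frac{pq}{pq-p-q},\infty\right)$ and $$\frac{1}{a}+\frac{1}{b}\leq\frac{3}{2}-\left(\frac{1}{p}+\frac{1}{q}\right).$$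
   Context: $\mathbb{K}$ is $\mathbb{R}$ or $\mathbb{C}$; $\ell_p^n$ is $\mathbb{K}^n$ with the $\ell_p$ norm; $e_i$ are the canonical unit vectors; $\|U\|=\sup\{|U(x,y)|:\|x\|_p\le1,\|y\|_q\le1\}$. Conventions: $\frac1\infty=0$, $\frac10=\infty$; the expressions $\frac{q}{q-1}$ and $\frac{pq}{pq-p-q}$ are read as $\left(1-\frac1q\right)^{-1}$ and $\left(1-\frac1p-\frac1q\right)^{-1}$ when $p$ or $q$ is infinite. *)

theory Defs
  imports Complex_Main "HOL-Library.Extended_Real"
begin

text \<open>Since \<open>n\<close> is quantified inside the statement, vectors of length \<open>n\<close> are sequences that
  vanish from index \<open>n\<close> on; coordinates are numbered \<open>0, \<dots>, n - 1\<close>.\<close>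

definition vecs :: "nat \<Rightarrow> (nat \<Rightarrow> 'k::real_normed_field) set" where
  "vecs n = {x. \<forall>i\<ge>n. x i = 0}"

definition unit_vector :: "nat \<Rightarrow> nat \<Rightarrow> 'k::real_normed_field" where
  "unit_vector i = (\<lambda>j. if j = i then 1 else 0)"

text \<open>Meaningful for \<open>n \<ge> 1\<close> and \<open>1 \<le> p\<close>.\<close>

definition lp_norm :: "ereal \<Rightarrow> nat \<Rightarrow> (nat \<Rightarrow> 'k::real_normed_field) \<Rightarrow> real" where
  "lp_norm p n x =
     (if p = \<infinity> then Max ((\<lambda>i. norm (x i)) ` {..<n})
      else (\<Sum>i<n. norm (x i) powr real_of_ereal p) powr (1 / real_of_ereal p))"

text \<open>The scalars \<open>c\<close> range over the field \<open>'k\<close> itself: for \<open>'k = complex\<close> this is complex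
  bilinearity. Values of \<open>U\<close> outside \<open>vecs n\<close> are irrelevant.\<close>

definition bilinear_form ::
    "nat \<Rightarrow> ((nat \<Rightarrow> 'k::real_normed_field) \<Rightarrow> (nat \<Rightarrow> 'k) \<Rightarrow> 'k) \<Rightarrow> bool" where
  "bilinear_form n U \<longleftrightarrow>
     (\<forall>x\<in>vecs n. \<forall>x'\<in>vecs n. \<forall>y\<in>vecs n. U (\<lambda>i. x i + x' i) y = U x y + U x' y) \<and>
     (\<forall>x\<in>vecs n. \<forall>y\<in>vecs n. \<forall>y'\<in>vecs n. U x (\<lambda>i. y i + y' i) = U x y + U x y') \<and>
     (\<forall>c. \<forall>x\<in>vecs n. \<forall>y\<in>vecs n. U (\<lambda>i. c * x i) y = c * U x y) \<and>
     (\<forall>c. \<forall>x\<in>vecs n. \<forall>y\<in>vecs n. U x (\<lambda>i. c * y i) = c * U x y)"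

text \<open>The set below is nonempty, and bounded above for bilinear \<open>U\<close> (finite dimension), so the real
  supremum is the true one.\<close>

definition form_norm ::
    "ereal \<Rightarrow> ereal \<Rightarrow> nat \<Rightarrow> ((nat \<Rightarrow> 'k::real_normed_field) \<Rightarrow> (nat \<Rightarrow> 'k) \<Rightarrow> 'k) \<Rightarrow> real" where
  "form_norm p q n U =
     Sup {norm (U x y) |x y. x \<in> vecs n \<and> y \<in> vecs n \<and> lp_norm p n x \<le> 1 \<and> lp_norm q n y \<le> 1}"

definition mixed_sum ::
    "real \<Rightarrow> real \<Rightarrow> nat \<Rightarrow> ((nat \<Rightarrow> 'k::real_normed_field) \<Rightarrow> (nat \<Rightarrow> 'k) \<Rightarrow> 'k) \<Rightarrow> real" where
  "mixed_sum a b n U =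
     (\<Sum>i<n. (\<Sum>j<n. norm (U (unit_vector i) (unit_vector j)) powr a) powr (1 / a * b)) powr (1 / b)"

text \<open>In \<open>ereal\<close> one has \<open>1 / \<infinity> = 0\<close>. The bounds \<open>q / (q - 1)\<close> and \<open>p q / (p q - p - q)\<close> are written
  \<open>inverse (1 - 1 / q)\<close> and \<open>inverse (1 - 1 / p - 1 / q)\<close>, which also covers infinite exponents.\<close>

definition admissible :: "ereal \<Rightarrow> ereal \<Rightarrow> real \<Rightarrow> real \<Rightarrow> bool" where
  "admissible p q a b \<longleftrightarrow>
     inverse (1 - 1 / q) \<le> ereal a \<and>
     inverse (1 - 1 / p - 1 / q) \<le> ereal b \<and>
     ereal (1 / a + 1 / b) \<le> 3 / 2 - (1 / p + 1 / q)"

end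

theory Submission
  imports Defs "HOL-Analysis.Convex"
begin

text \<open>
  Write \<open>P = 1 / p\<close>, \<open>Q = 1 / q\<close>, \<open>\<alpha> = 1 / a\<close>, \<open>\<beta> = 1 / b\<close>. Necessity of the three inequalities
  \<open>\<alpha> \<le> 1 - Q\<close>, \<open>\<beta> \<le> 1 - P - Q\<close>, \<open>\<alpha> + \<beta> \<le> 3 / 2 - P - Q\<close> is seen on a single row of ones, on the
  identity matrix, and on an orthogonal sign matrix, whose form has norm at most
  \<open>n\<^sup>1\<^sup>/\<^sup>2 n\<^sup>1\<^sup>/\<^sup>2\<^sup>-\<^sup>P n\<^sup>1\<^sup>/\<^sup>2\<^sup>-\<^sup>Q\<close> because \<open>p, q \<ge> 2\<close>.

  For sufficiency, replacing \<open>u i j\<close> by \<open>x i * u i j\<close> with the extremal \<open>x\<close> in the unit ball of \<open>\<ell>\<^sub>p\<close>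
  reduces to \<open>p = \<infinity>\<close>, and larger exponents give smaller norms, so that only
  \<open>1 / 2 \<le> \<alpha> \<le> 1 - Q\<close>, \<open>\<alpha> + \<beta> = 3 / 2 - Q\<close> remains. There Khinchine's inequality is applied in both
  variables: in the first it bounds the \<open>\<ell>\<^sub>s\<close> norm, \<open>1 / s = 1 - Q\<close>, of the Euclidean lengths of the
  columns; in the second, with the matrix weighted by powers of these column lengths, it bounds the sum of the
  Euclidean lengths of the rows. Hoelder's inequality interpolates between the two.
\<close>

section \<open>Hoelder's inequality with weights\<close>

lemma weighted_am_gm3:
  fixes f g h x y z :: real
  assumes "f \<ge> 0" "g \<ge> 0" "h \<ge> 0" and w: "x \<ge> 0" "y \<ge> 0" "z \<ge> 0" "x + y + z = 1"
  shows "f powr x * g powr y * h powr z \<le> x * f + y * g + z * h"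
proof (cases "f = 0 \<or> g = 0 \<or> h = 0")
  case True
  then show ?thesis using assms by auto
next
  case False
  with assms have pos: "f > 0" "g > 0" "h > 0" by auto
  define m where "m = x * f + y * g + z * h"
  have "m > 0"
  proof -
    have "x > 0 \<or> y > 0 \<or> z > 0" using w by linarith
    then show ?thesis
      unfolding m_def using w pos
      by (elim disjE) (simp_all add: add_pos_nonneg add_nonneg_pos)
  qed
  have ln_le: "ln t \<le> ln m + (t / m - 1)" if "t > 0" for t
    using ln_le_minus_one[of "t / m"] that \<open>m > 0\<close> by (simp add: ln_div)
  have "x * ln f + y * ln g + z * ln h
      \<le> x * (ln m + (f / m - 1)) + y * (ln m + (g / m - 1)) + z * (ln m + (h / m - 1))"
    using w pos by (intro add_mono mult_left_mono ln_le) simp_all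
  also have "\<dots> = (x + y + z) * (ln m - 1) + (x * f + y * g + z * h) / m"
    by (simp add: algebra_simps add_divide_distrib)
  also have "\<dots> = ln m"
    using \<open>m > 0\<close> w unfolding m_def[symmetric] by simp
  finally have "exp (x * ln f + y * ln g + z * ln h) \<le> m"
    using \<open>m > 0\<close> by (simp add: ln_ge_iff[symmetric])
  then show ?thesis
    using pos by (simp add: powr_def exp_add m_def)
qed

lemma Holder_sum3:
  fixes f g h :: "'i \<Rightarrow> real"
  assumes nn: "\<And>i. i \<in> A \<Longrightarrow> f i \<ge> 0" "\<And>i. i \<in> A \<Longrightarrow> g i \<ge> 0" "\<And>i. i \<in> A \<Longrightarrow> h i \<ge> 0"
    and w: "x \<ge> 0" "y \<ge> 0" "z \<ge> 0" "x + y + z = 1"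
  shows "(\<Sum>i\<in>A. f i powr x * g i powr y * h i powr z)
     \<le> sum f A powr x * sum g A powr y * sum h A powr z"
proof (cases "finite A \<and> sum f A \<noteq> 0 \<and> sum g A \<noteq> 0 \<and> sum h A \<noteq> 0")
  case False
  then have "(\<Sum>i\<in>A. f i powr x * g i powr y * h i powr z) = 0"
    using nn by (auto simp: sum_nonneg_eq_0_iff)
  then show ?thesis by simp
next
  case True
  let ?F = "sum f A" and ?G = "sum g A" and ?H = "sum h A"
  have "?F \<ge> 0" "?G \<ge> 0" "?H \<ge> 0"
    by (auto intro!: sum_nonneg nn)
  then have pos: "?F > 0" "?G > 0" "?H > 0"
    using True by auto
  have "(\<Sum>i\<in>A. (f i / ?F) powr x * (g i / ?G) powr y * (h i / ?H) powr z)
      \<le> (\<Sum>i\<in>A. x * (f i / ?F) + y * (g i / ?G) + z * (h i / ?H))"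
    using pos nn w by (intro sum_mono weighted_am_gm3) auto
  also have "\<dots> = x * (?F / ?F) + y * (?G / ?G) + z * (?H / ?H)"
    by (simp only: sum.distrib sum_distrib_left[symmetric] sum_divide_distrib[symmetric])
  also have "\<dots> = 1"
    using pos w by simp
  finally have "(\<Sum>i\<in>A. f i powr x * g i powr y * h i powr z)
      / (?F powr x * ?G powr y * ?H powr z) \<le> 1"
    using pos nn by (simp add: powr_divide sum_divide_distrib)
  then show ?thesis
    using pos by (simp add: divide_le_eq)
qed

lemma Holder_sum2:
  fixes f g :: "'i \<Rightarrow> real"
  assumes "\<And>i. i \<in> A \<Longrightarrow> f i \<ge> 0" "\<And>i. i \<in> A \<Longrightarrow> g i \<ge> 0"
    and "x \<ge> 0" "y \<ge> 0" "x + y = 1"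
  shows "(\<Sum>i\<in>A. f i powr x * g i powr y) \<le> sum f A powr x * sum g A powr y"
proof -
  have *: "t powr y * t powr 0 = t powr y" for t :: real
    by simp
  show ?thesis
    using Holder_sum3[of A f g g x y 0] assms by (simp only: mult.assoc *)
qed

lemma sum_powr_mono_exponent:
  fixes t :: "'i \<Rightarrow> real"
  assumes nn: "\<And>i. i \<in> A \<Longrightarrow> t i \<ge> 0" and "0 < r" "r \<le> s"
  shows "(\<Sum>i\<in>A. t i powr s) powr (1 / s) \<le> (\<Sum>i\<in>A. t i powr r) powr (1 / r)"
proof (cases "finite A")
  case fin: True
  define S where "S = (\<Sum>i\<in>A. t i powr r)"
  have "S \<ge> 0" unfolding S_def by (intro sum_nonneg) auto
  have le: "t i \<le> S powr (1 / r)" if "i \<in> A" for i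
  proof -
    have "t i powr r \<le> S"
      unfolding S_def using that fin by (intro member_le_sum) auto
    then have "(t i powr r) powr (1 / r) \<le> S powr (1 / r)"
      using assms by (intro powr_mono2) auto
    then show ?thesis
      using nn[OF that] assms by (simp add: powr_powr)
  qed
  have "(\<Sum>i\<in>A. t i powr s) = (\<Sum>i\<in>A. t i powr r * t i powr (s - r))"
    by (simp add: powr_add[symmetric])
  also have "\<dots> \<le> (\<Sum>i\<in>A. t i powr r * (S powr (1 / r)) powr (s - r))"
    using le nn assms by (intro sum_mono mult_left_mono powr_mono2) auto
  also have "\<dots> = S * S powr ((s - r) / r)"
    by (simp add: S_def sum_distrib_right powr_powr)
  also have "\<dots> = S powr (1 + (s - r) / r)"
    using \<open>S \<ge> 0\<close> by (cases "S = 0") (auto simp: powr_add)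
  also have "1 + (s - r) / r = s / r"
    using assms by (simp add: field_simps)
  finally have "(\<Sum>i\<in>A. t i powr s) powr (1 / s) \<le> (S powr (s / r)) powr (1 / s)"
    using assms by (intro powr_mono2 sum_nonneg) auto
  then show ?thesis
    using assms by (simp add: S_def powr_powr)
qed auto

section \<open>Khinchine's inequality\<close>

lemma norm_power4_parallelogram:
  fixes z a :: "'a::real_inner"
  shows "norm (z + a) ^ 4 + norm (z - a) ^ 4
    \<le> 2 * (norm z ^ 4 + 6 * (norm z)\<^sup>2 * (norm a)\<^sup>2 + norm a ^ 4)"
proof -
  have p4: "t ^ 4 = (t\<^sup>2)\<^sup>2" for t :: real by simp
  have 1: "(norm (z + a))\<^sup>2 = (norm z)\<^sup>2 + 2 * inner z a + (norm a)\<^sup>2"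
    and 2: "(norm (z - a))\<^sup>2 = (norm z)\<^sup>2 - 2 * inner z a + (norm a)\<^sup>2"
    by (simp_all add: power2_norm_eq_inner inner_add inner_diff inner_commute)
  have "\<bar>inner z a\<bar> \<le> norm z * norm a"
    by (rule Cauchy_Schwarz_ineq2)
  then have "(inner z a)\<^sup>2 \<le> (norm z)\<^sup>2 * (norm a)\<^sup>2"
    by (simp add: abs_le_square_iff[symmetric] power_mult_distrib[symmetric])
  then show ?thesis
    unfolding p4 1 2 by (simp add: power2_eq_square algebra_simps)
qed

lemma norm_power2_parallelogram:
  fixes z a :: "'a::real_inner"
  shows "(norm (z + a))\<^sup>2 + (norm (z - a))\<^sup>2 = 2 * ((norm z)\<^sup>2 + (norm a)\<^sup>2)"
  by (simp add: power2_norm_eq_inner inner_add inner_diff inner_commute)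

text \<open>\<open>G\<close> is the conditional expectation, over the signs still to be chosen, of
  \<open>l k * \<bar>X\<^sub>k\<bar>\<^sup>2 - m k * \<bar>X\<^sub>k\<bar>\<^sup>4\<close> with the fourth moment replaced by its upper bound; choosing the
  signs one at a time keeps its sum from decreasing.\<close>

lemma sign_choice_moments:
  fixes a :: "nat \<Rightarrow> 'i \<Rightarrow> 'a::real_inner" and z :: "'i \<Rightarrow> 'a" and l m :: "'i \<Rightarrow> real"
  assumes m: "\<And>k. m k \<ge> 0"
  defines "G \<equiv> \<lambda>k z s. l k * ((norm z)\<^sup>2 + s) - m k * (norm z ^ 4 + 6 * (norm z)\<^sup>2 * s + 3 * s\<^sup>2)"
  shows "\<exists>e :: nat \<Rightarrow> real. (\<forall>i. e i = 1 \<or> e i = -1) \<and>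
    (\<Sum>k\<in>K. G k (z k) (\<Sum>i<n. (norm (a i k))\<^sup>2))
      \<le> (\<Sum>k\<in>K. G k (z k + (\<Sum>i<n. e i *\<^sub>R a i k)) 0)"
proof (induction n arbitrary: z)
  case 0
  show ?case by (rule exI[of _ "\<lambda>_. 1"]) simp
next
  case (Suc n)
  define s where "s = (\<lambda>k. \<Sum>i<n. (norm (a i k))\<^sup>2)"
  define H where "H = (\<lambda>d. \<Sum>k\<in>K. G k (z k + d *\<^sub>R a n k) (s k))"
  have step: "2 * G k z (s k + (norm a)\<^sup>2) \<le> G k (z + a) (s k) + G k (z - a) (s k)" for k z a
  proof -
    let ?z = "(norm z)\<^sup>2" and ?a = "(norm a)\<^sup>2"
    have "G k (z + a) (s k) + G k (z - a) (s k)
        = l k * ((norm (z + a))\<^sup>2 + (norm (z - a))\<^sup>2 + 2 * s k)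
          - m k * (norm (z + a) ^ 4 + norm (z - a) ^ 4
              + 6 * ((norm (z + a))\<^sup>2 + (norm (z - a))\<^sup>2) * s k + 6 * (s k)\<^sup>2)"
      unfolding G_def by (simp add: algebra_simps)
    moreover have "norm (z + a) ^ 4 + norm (z - a) ^ 4
          + 6 * ((norm (z + a))\<^sup>2 + (norm (z - a))\<^sup>2) * s k + 6 * (s k)\<^sup>2
        \<le> 2 * (norm z ^ 4 + 6 * ?z * (s k + ?a) + 3 * (s k + ?a)\<^sup>2)"
    proof -
      have "2 * (norm z ^ 4 + 6 * ?z * (s k + ?a) + 3 * (s k + ?a)\<^sup>2)
          = 2 * (norm z ^ 4 + 6 * ?z * ?a + norm a ^ 4)
            + 6 * (2 * (?z + ?a)) * s k + 6 * (s k)\<^sup>2 + 4 * norm a ^ 4"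
        by (simp add: power2_eq_square power4_eq_xxxx algebra_simps)
      moreover have "norm a ^ 4 \<ge> 0" by simp
      ultimately show ?thesis
        using norm_power4_parallelogram[of z a] unfolding norm_power2_parallelogram by linarith
    qed
    then have "m k * (norm (z + a) ^ 4 + norm (z - a) ^ 4
          + 6 * ((norm (z + a))\<^sup>2 + (norm (z - a))\<^sup>2) * s k + 6 * (s k)\<^sup>2)
        \<le> m k * (2 * (norm z ^ 4 + 6 * ?z * (s k + ?a) + 3 * (s k + ?a)\<^sup>2))"
      by (rule mult_left_mono[OF _ m])
    ultimately show ?thesis
      unfolding norm_power2_parallelogram by (simp add: G_def algebra_simps)
  qed
  have "2 * (\<Sum>k\<in>K. G k (z k) (s k + (norm (a n k))\<^sup>2)) \<le> H 1 + H (-1)"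
    unfolding H_def sum_distrib_left sum.distrib[symmetric] using step by (intro sum_mono) simp
  then have "(\<exists>d :: real. (d = 1 \<or> d = -1) \<and>
      (\<Sum>k\<in>K. G k (z k) (s k + (norm (a n k))\<^sup>2)) \<le> H d)"
    by (cases "(\<Sum>k\<in>K. G k (z k) (s k + (norm (a n k))\<^sup>2)) \<le> H 1") force+
  then obtain d :: real where d: "d = 1 \<or> d = -1"
    and le: "(\<Sum>k\<in>K. G k (z k) (s k + (norm (a n k))\<^sup>2)) \<le> H d"
    by blast
  obtain e :: "nat \<Rightarrow> real" where e: "\<forall>i. e i = 1 \<or> e i = -1"
    and IH: "H d \<le> (\<Sum>k\<in>K. G k (z k + d *\<^sub>R a n k + (\<Sum>i<n. e i *\<^sub>R a i k)) 0)"
    using Suc.IH[of "\<lambda>k. z k + d *\<^sub>R a n k"] unfolding H_def s_def by blast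
  show ?case
  proof (rule exI[of _ "e(n := d)"], intro conjI)
    show "\<forall>i. (e(n := d)) i = 1 \<or> (e(n := d)) i = -1"
      using e d by simp
    show "(\<Sum>k\<in>K. G k (z k) (\<Sum>i<Suc n. (norm (a i k))\<^sup>2))
        \<le> (\<Sum>k\<in>K. G k (z k + (\<Sum>i<Suc n. (e(n := d)) i *\<^sub>R a i k)) 0)"
      using order.trans[OF le IH] by (simp add: s_def add_ac)
  qed
qed

text \<open>Khinchine's inequality in \<open>L\<^sub>1\<close>: with unit variance, \<open>t \<ge> t\<^sup>2 - t\<^sup>4 / 6\<close> and a fourth moment of at most
  \<open>3\<close> give a first moment of at least \<open>1 / 2\<close>. One choice of signs serves a whole finite family.\<close>

lemma Khinchine_signs:
  fixes a :: "nat \<Rightarrow> 'i \<Rightarrow> 'a::real_inner"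
  shows "\<exists>e :: nat \<Rightarrow> real. (\<forall>i. e i = 1 \<or> e i = -1) \<and>
    (\<Sum>k\<in>K. sqrt (\<Sum>i<n. (norm (a i k))\<^sup>2)) \<le> 2 * (\<Sum>k\<in>K. norm (\<Sum>i<n. e i *\<^sub>R a i k))"
proof -
  define s where "s = (\<lambda>k. sqrt (\<Sum>i<n. (norm (a i k))\<^sup>2))"
  have s: "s k \<ge> 0" "(\<Sum>i<n. (norm (a i k))\<^sup>2) = (s k)\<^sup>2" for k
    by (simp_all add: s_def sum_nonneg)
  obtain e :: "nat \<Rightarrow> real" where e: "\<forall>i. e i = 1 \<or> e i = -1"
    and le: "(\<Sum>k\<in>K. 1 / s k * (s k)\<^sup>2 - 1 / (6 * s k ^ 3) * (3 * ((s k)\<^sup>2)\<^sup>2))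
      \<le> (\<Sum>k\<in>K. 1 / s k * (norm (\<Sum>i<n. e i *\<^sub>R a i k))\<^sup>2
            - 1 / (6 * s k ^ 3) * norm (\<Sum>i<n. e i *\<^sub>R a i k) ^ 4)"
    using sign_choice_moments[of "\<lambda>k. 1 / (6 * s k ^ 3)" "\<lambda>k. 1 / s k" "\<lambda>_. 0" a n K] s
    by (auto)
  have 1: "1 / s k * (s k)\<^sup>2 - 1 / (6 * s k ^ 3) * (3 * ((s k)\<^sup>2)\<^sup>2) = s k / 2" for k
    by (cases "s k = 0") (auto simp: field_simps power2_eq_square power3_eq_cube)
  have 2: "1 / s k * t\<^sup>2 - 1 / (6 * s k ^ 3) * t ^ 4 \<le> t" if "t \<ge> 0" for k t
  proof (cases "s k = 0")
    case False
    define r where "r = t / s k"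
    have sp: "s k > 0" using False s(1)[of k] by simp
    have t: "t = r * s k" and r: "r \<ge> 0" using sp that by (simp_all add: r_def)
    have "(r - 10/7)\<^sup>2 * (r + 20/7) \<ge> 0" using r by simp
    moreover have "(r - 10/7)\<^sup>2 * (r + 20/7) = r ^ 3 - 300/49 * r + 2000/343"
      by (simp add: power2_eq_square power3_eq_cube field_simps)
    ultimately have "6 - 6 * r + r ^ 3 \<ge> 0"
      using r by linarith
    then have "r * s k * (6 - 6 * r + r ^ 3) \<ge> 0"
      using r sp by simp
    then show ?thesis
      using sp unfolding t by (simp add: field_simps power2_eq_square power3_eq_cube power4_eq_xxxx)
  qed (use that in auto)
  have "(\<Sum>k\<in>K. s k) = 2 * (\<Sum>k\<in>K. s k / 2)"
    by (simp add: sum_distrib_left)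
  also have "\<dots> \<le> 2 * (\<Sum>k\<in>K. norm (\<Sum>i<n. e i *\<^sub>R a i k))"
    using order.trans[OF le[unfolded 1] sum_mono[OF 2]] by simp
  finally show ?thesis
    using e unfolding s_def by blast
qed

section \<open>The mixed inequality for matrices\<close>

lemma norm_phase:
  fixes x :: "'k::real_normed_field"
  shows "\<exists>d. norm d \<le> 1 \<and> d * x = of_real (norm x)"
  by (rule exI[of _ "if x = 0 then 0 else of_real (norm x) / x"]) (auto simp: norm_divide)

lemma mixed_inequality_sup:
  fixes v :: "nat \<Rightarrow> nat \<Rightarrow> 'k::{real_normed_field,real_inner}" and Q \<alpha> \<beta> M :: real
  assumes Q: "0 \<le> Q" "Q \<le> 1 / 2" and \<alpha>: "1 / 2 \<le> \<alpha>" "\<alpha> \<le> 1 - Q"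
    and \<beta>: "\<beta> = 3 / 2 - Q - \<alpha>" and M: "M \<ge> 0"
    and bound: "\<And>c d z. (\<And>i. norm (c i) \<le> 1) \<Longrightarrow> (\<And>j. norm (d j) \<le> 1) \<Longrightarrow> (\<And>j. z j \<ge> 0) \<Longrightarrow>
      norm (\<Sum>i<n. \<Sum>j<n. c i * v i j * (d j * of_real (z j powr Q))) \<le> M * (\<Sum>j<n. z j) powr Q"
  shows "(\<Sum>i<n. (\<Sum>j<n. norm (v i j) powr (1 / \<alpha>)) powr (\<alpha> / \<beta>)) powr \<beta> \<le> 2 * M"
proof -
  define \<sigma> where "\<sigma> = 1 - Q"
  have \<sigma>: "\<sigma> > 0" and pos: "\<alpha> > 0" "\<beta> > 0" using Q \<alpha> \<beta> by (auto simp: \<sigma>_def)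
  define R where "R = (\<lambda>j. sqrt (\<Sum>i<n. (norm (v i j))\<^sup>2))"
  define g where "g = (\<lambda>j. R j powr (1 / \<sigma>))"
  define \<rho> where "\<rho> = (\<Sum>j<n. g j)"
  have R0: "R j \<ge> 0" for j by (simp add: R_def sum_nonneg)
  have g0: "g j \<ge> 0" for j by (simp add: g_def)
  have \<rho>0: "\<rho> \<ge> 0" by (simp add: \<rho>_def sum_nonneg g0)
  have Rg: "R j = g j powr \<sigma>" for j
    using \<sigma> R0[of j] by (simp add: g_def powr_powr)
  have v0: "v i j = 0" if "g j = 0" "i < n" for i j
  proof -
    have "(\<Sum>i<n. (norm (v i j))\<^sup>2) = 0"
      using that Rg[of j] by (simp add: R_def)
    then show ?thesis
      using that by (subst (asm) sum_nonneg_eq_0_iff) auto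
  qed
  define y where "y = (\<lambda>j. of_real (g j powr Q) :: 'k)"
  have ny: "norm (y j) = g j powr Q" for j by (simp add: y_def)

  have columns: "\<rho> \<le> 2 * (M * \<rho> powr Q)"
  proof -
    obtain e :: "nat \<Rightarrow> real" where e: "\<And>i. e i = 1 \<or> e i = -1"
      and le: "(\<Sum>j<n. sqrt (\<Sum>i<n. (norm (v i j * y j))\<^sup>2))
        \<le> 2 * (\<Sum>j<n. norm (\<Sum>i<n. e i *\<^sub>R (v i j * y j)))"
      using Khinchine_signs[where a = "\<lambda>i j. v i j * y j" and n = n and K = "{..<n}"] by blast
    obtain d where d: "\<And>j. norm (d j) \<le> 1"
        "\<And>j. d j * (\<Sum>i<n. e i *\<^sub>R (v i j * y j)) = of_real (norm (\<Sum>i<n. e i *\<^sub>R (v i j * y j)))"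
      using norm_phase[of "\<Sum>i<n. e i *\<^sub>R (v i j * y j)" for j] by metis
    have "(\<Sum>i<n. \<Sum>j<n. of_real (e i) * v i j * (d j * of_real (g j powr Q)))
        = (\<Sum>j<n. d j * (\<Sum>i<n. e i *\<^sub>R (v i j * y j)))"
      by (subst sum.swap) (simp add: sum_distrib_left y_def scaleR_conv_of_real mult_ac)
    also have "\<dots> = of_real (\<Sum>j<n. norm (\<Sum>i<n. e i *\<^sub>R (v i j * y j)))"
      by (simp add: d)
    finally have "(\<Sum>j<n. norm (\<Sum>i<n. e i *\<^sub>R (v i j * y j)))
        = norm (\<Sum>i<n. \<Sum>j<n. of_real (e i) * v i j * (d j * of_real (g j powr Q)))"
      by (simp only: norm_of_real) (simp add: sum_nonneg)
    also have "\<dots> \<le> M * \<rho> powr Q"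
      unfolding \<rho>_def using d(1) g0
    proof (intro bound)
      show "norm (of_real (e i) :: 'k) \<le> 1" for i using e[of i] by auto
    qed auto
    finally have "(\<Sum>j<n. sqrt (\<Sum>i<n. (norm (v i j * y j))\<^sup>2)) \<le> 2 * (M * \<rho> powr Q)"
      using le by linarith
    moreover have "sqrt (\<Sum>i<n. (norm (v i j * y j))\<^sup>2) = g j" for j
    proof -
      have "sqrt (\<Sum>i<n. (norm (v i j * y j))\<^sup>2) = R j * g j powr Q"
        by (simp add: norm_mult ny power_mult_distrib sum_distrib_right[symmetric] real_sqrt_mult R_def)
      also have "\<dots> = g j"
        using g0[of j] by (simp add: Rg powr_add[symmetric] \<sigma>_def)
      finally show ?thesis .
    qed
    ultimately show ?thesis by (simp add: \<rho>_def)
  qed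

  define A where "A = (\<lambda>i. \<Sum>j<n. (norm (v i j))\<^sup>2 * (g j powr Q)\<^sup>2)"
  define B where "B = (\<lambda>i. \<Sum>j<n. (norm (v i j))\<^sup>2 * g j powr (1 - 2 * \<sigma>))"
  have A0: "A i \<ge> 0" and B0: "B i \<ge> 0" for i
    by (simp_all add: A_def B_def sum_nonneg)
  have rows: "(\<Sum>i<n. sqrt (A i)) \<le> 2 * (M * \<rho> powr Q)"
  proof -
    obtain e :: "nat \<Rightarrow> real" where e: "\<And>i. e i = 1 \<or> e i = -1"
      and le: "(\<Sum>i<n. sqrt (\<Sum>j<n. (norm (v i j * y j))\<^sup>2))
        \<le> 2 * (\<Sum>i<n. norm (\<Sum>j<n. e j *\<^sub>R (v i j * y j)))"
      using Khinchine_signs[where a = "\<lambda>j i. v i j * y j" and n = n and K = "{..<n}"] by blast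
    obtain c where c: "\<And>i. norm (c i) \<le> 1"
        "\<And>i. c i * (\<Sum>j<n. e j *\<^sub>R (v i j * y j)) = of_real (norm (\<Sum>j<n. e j *\<^sub>R (v i j * y j)))"
      using norm_phase[of "\<Sum>j<n. e j *\<^sub>R (v i j * y j)" for i] by metis
    have "(\<Sum>i<n. \<Sum>j<n. c i * v i j * (of_real (e j) * of_real (g j powr Q)))
        = (\<Sum>i<n. c i * (\<Sum>j<n. e j *\<^sub>R (v i j * y j)))"
      by (simp add: sum_distrib_left y_def scaleR_conv_of_real mult_ac)
    also have "\<dots> = of_real (\<Sum>i<n. norm (\<Sum>j<n. e j *\<^sub>R (v i j * y j)))"
      by (simp add: c)
    finally have "(\<Sum>i<n. norm (\<Sum>j<n. e j *\<^sub>R (v i j * y j)))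
        = norm (\<Sum>i<n. \<Sum>j<n. c i * v i j * (of_real (e j) * of_real (g j powr Q)))"
      by (simp only: norm_of_real) (simp add: sum_nonneg)
    also have "\<dots> \<le> M * \<rho> powr Q"
      unfolding \<rho>_def using c(1) g0
    proof (intro bound)
      show "norm (of_real (e j) :: 'k) \<le> 1" for j using e[of j] by auto
    qed auto
    finally show ?thesis
      using le by (simp add: A_def norm_mult ny power_mult_distrib)
  qed
  have sumB: "(\<Sum>i<n. B i) = \<rho>"
  proof -
    have "(\<Sum>i<n. B i) = (\<Sum>j<n. (\<Sum>i<n. (norm (v i j))\<^sup>2) * g j powr (1 - 2 * \<sigma>))"
      unfolding B_def by (subst sum.swap) (simp add: sum_distrib_right)
    also have "\<dots> = (\<Sum>j<n. g j)"
    proof (rule sum.cong)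
      fix j
      have "(\<Sum>i<n. (norm (v i j))\<^sup>2) = (R j)\<^sup>2"
        by (simp add: R_def sum_nonneg)
      also have "\<dots> = g j powr (2 * \<sigma>)"
        unfolding Rg power2_eq_square powr_add[symmetric] by simp
      finally show "(\<Sum>i<n. (norm (v i j))\<^sup>2) * g j powr (1 - 2 * \<sigma>) = g j"
        using g0[of j] by (simp add: powr_add[symmetric])
    qed simp
    finally show ?thesis by (simp add: \<rho>_def)
  qed

  define \<iota> where "\<iota> = 1 / \<alpha>"
  have \<iota>: "\<iota> * \<alpha> = 1" using pos by (simp add: \<iota>_def)
  define x1 x2 x3 where x123: "x1 = \<sigma> * \<iota> - 1" "x2 = \<iota> / 2 - (\<sigma> * \<iota> - 1)" "x3 = 1 - \<iota> / 2"
  have x0: "x1 \<ge> 0" "x2 \<ge> 0" "x3 \<ge> 0" and x1: "x1 + x2 + x3 = 1"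
    using \<alpha> Q pos unfolding x123 \<sigma>_def \<iota>_def by (auto simp: field_simps)
  have row: "(\<Sum>j<n. norm (v i j) powr (1 / \<alpha>)) \<le> A i powr x1 * B i powr x2 * \<rho> powr x3"
    if "i < n" for i
  proof -
    have "(\<Sum>j<n. norm (v i j) powr (1 / \<alpha>))
        = (\<Sum>j<n. ((norm (v i j))\<^sup>2 * (g j powr Q)\<^sup>2) powr x1
            * ((norm (v i j))\<^sup>2 * g j powr (1 - 2 * \<sigma>)) powr x2 * g j powr x3)"
    proof (rule sum.cong)
      fix j
      show "norm (v i j) powr (1 / \<alpha>) = ((norm (v i j))\<^sup>2 * (g j powr Q)\<^sup>2) powr x1
            * ((norm (v i j))\<^sup>2 * g j powr (1 - 2 * \<sigma>)) powr x2 * g j powr x3"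
      proof (cases "v i j = 0")
        case False
        then have gp: "g j > 0" and vp: "norm (v i j) > 0"
          using v0[of j i] that g0[of j] by (auto simp: order_less_le)
        have sq: "t\<^sup>2 = t powr 2" if "t > 0" for t :: real
          using that by simp
        have e1: "2 * x1 + 2 * x2 = 1 / \<alpha>"
          unfolding x123 \<iota>_def by simp
        have e2: "2 * Q * x1 + (1 - 2 * \<sigma>) * x2 + x3 = 0"
          unfolding x123 \<sigma>_def by (simp add: algebra_simps)
        have "((norm (v i j))\<^sup>2 * (g j powr Q)\<^sup>2) powr x1
              * ((norm (v i j))\<^sup>2 * g j powr (1 - 2 * \<sigma>)) powr x2 * g j powr x3
            = norm (v i j) powr (2 * x1 + 2 * x2) * g j powr (2 * Q * x1 + (1 - 2 * \<sigma>) * x2 + x3)"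
          using gp vp by (simp add: sq powr_mult powr_powr powr_add mult_ac del: powr_numeral)
        then show ?thesis
          using gp by (simp only: e1 e2) simp
      qed simp
    qed simp
    also have "\<dots> \<le> A i powr x1 * B i powr x2 * \<rho> powr x3"
      unfolding A_def B_def \<rho>_def by (intro Holder_sum3 x0 x1) (auto simp: g0)
    finally show ?thesis .
  qed
  have h: "2 * x1 * (\<alpha> / \<beta>) + x2 * (\<alpha> / \<beta>) = 1"
  proof -
    have "(2 * x1 + x2) * \<alpha> = \<sigma> * (\<iota> * \<alpha>) - \<alpha> + (\<iota> * \<alpha>) / 2"
      by (simp add: x123 algebra_simps)
    then have "(2 * x1 + x2) * \<alpha> = \<beta>"
      unfolding \<iota> by (simp add: \<beta> \<sigma>_def)
    moreover have "2 * x1 * (\<alpha> / \<beta>) + x2 * (\<alpha> / \<beta>) = (2 * x1 + x2) * \<alpha> / \<beta>"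
      by (simp add: algebra_simps add_divide_distrib)
    ultimately show ?thesis using pos by simp
  qed
  have "(\<Sum>i<n. (\<Sum>j<n. norm (v i j) powr (1 / \<alpha>)) powr (\<alpha> / \<beta>))
      \<le> (\<Sum>i<n. (A i powr x1 * B i powr x2 * \<rho> powr x3) powr (\<alpha> / \<beta>))"
    using pos by (intro sum_mono powr_mono2 row) (auto intro: sum_nonneg)
  also have "\<dots> = (\<Sum>i<n. sqrt (A i) powr (2 * x1 * (\<alpha> / \<beta>)) * B i powr (x2 * (\<alpha> / \<beta>)))
      * \<rho> powr (x3 * (\<alpha> / \<beta>))"
    using A0 B0 by (simp add: powr_mult powr_powr sum_distrib_right powr_half_sqrt[symmetric])
  also have "\<dots> \<le> ((\<Sum>i<n. sqrt (A i)) powr (2 * x1 * (\<alpha> / \<beta>)) * (\<Sum>i<n. B i) powr (x2 * (\<alpha> / \<beta>)))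
      * \<rho> powr (x3 * (\<alpha> / \<beta>))"
    using x0 pos h A0 B0 by (intro mult_right_mono Holder_sum2) auto
  also have "\<dots> \<le> (2 * (M * \<rho> powr Q)) powr (2 * x1 * (\<alpha> / \<beta>)) * \<rho> powr (x2 * (\<alpha> / \<beta>))
      * \<rho> powr (x3 * (\<alpha> / \<beta>))"
    using x0 pos rows A0 unfolding sumB
    by (intro mult_right_mono powr_mono2) (auto intro: sum_nonneg)
  finally have "(\<Sum>i<n. (\<Sum>j<n. norm (v i j) powr (1 / \<alpha>)) powr (\<alpha> / \<beta>)) powr \<beta>
     \<le> ((2 * (M * \<rho> powr Q)) powr (2 * x1 * (\<alpha> / \<beta>)) * \<rho> powr (x2 * (\<alpha> / \<beta>))
      * \<rho> powr (x3 * (\<alpha> / \<beta>))) powr \<beta>"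
    using pos by (intro powr_mono2) (auto intro: sum_nonneg)
  also have "\<dots> = (2 * (M * \<rho> powr Q)) powr (2 * x1 * \<alpha>) * \<rho> powr (x2 * \<alpha>) * \<rho> powr (x3 * \<alpha>)"
    using pos M \<rho>0 by (simp add: powr_mult powr_powr)
  also have "\<dots> \<le> 2 * M"
  proof (cases "\<rho> = 0")
    case False
    then have \<rho>p: "\<rho> > 0" using \<rho>0 by simp
    have "\<rho> powr \<sigma> * \<rho> powr Q \<le> 2 * M * \<rho> powr Q"
      using columns \<rho>p by (simp add: powr_add[symmetric] \<sigma>_def mult_ac)
    then have le: "\<rho> powr \<sigma> \<le> 2 * M"
      using \<rho>p by simp
    then have Mp: "M > 0"
      using \<rho>p by (smt (verit) powr_gt_zero)
    have "(\<rho> powr \<sigma>) powr (1 / \<sigma>) \<le> (2 * M) powr (1 / \<sigma>)"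
      using le \<sigma> by (intro powr_mono2) auto
    then have \<rho>le: "\<rho> \<le> (2 * M) powr (1 / \<sigma>)"
      using \<rho>p \<sigma> by (simp add: powr_powr)
    let ?e = "Q * (2 * x1 * \<alpha>) + x2 * \<alpha> + x3 * \<alpha>"
    have e0: "?e \<ge> 0" using x0 Q pos by simp
    have e: "2 * x1 * \<alpha> + 1 / \<sigma> * ?e = 1"
    proof -
      have "?e = (\<iota> * \<alpha>) * (\<sigma> - 2 * \<sigma>\<^sup>2) + 2 * \<sigma> * \<alpha>"
        unfolding x123 \<sigma>_def by (simp add: algebra_simps power2_eq_square)
      also have "\<dots> = \<sigma> * (1 - 2 * \<sigma> + 2 * \<alpha>)"
        unfolding \<iota> by (simp add: algebra_simps power2_eq_square)
      finally have "1 / \<sigma> * ?e = 1 - 2 * \<sigma> + 2 * \<alpha>"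
        using \<sigma> by simp
      moreover have "2 * x1 * \<alpha> = 2 * \<sigma> * (\<iota> * \<alpha>) - 2 * \<alpha>"
        by (simp add: x123 algebra_simps)
      ultimately show ?thesis unfolding \<iota> by simp
    qed
    have "(2 * (M * \<rho> powr Q)) powr (2 * x1 * \<alpha>) * \<rho> powr (x2 * \<alpha>) * \<rho> powr (x3 * \<alpha>)
        = (2 * M) powr (2 * x1 * \<alpha>) * \<rho> powr ?e"
      using Mp \<rho>p by (simp add: powr_mult powr_powr powr_add mult_ac)
    also have "\<dots> \<le> (2 * M) powr (2 * x1 * \<alpha>) * ((2 * M) powr (1 / \<sigma>)) powr ?e"
      using \<rho>le \<rho>p e0 by (intro mult_left_mono powr_mono2) auto
    also have "\<dots> = (2 * M) powr (2 * x1 * \<alpha> + 1 / \<sigma> * ?e)"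
      by (simp only: powr_powr powr_add[of _ "2 * x1 * \<alpha>" "1 / \<sigma> * ?e"])
    also have "\<dots> = 2 * M"
      unfolding e using Mp by simp
    finally show ?thesis .
  qed (use M in simp)
  finally show ?thesis .
qed

lemma mixed_inequality_core:
  fixes u :: "nat \<Rightarrow> nat \<Rightarrow> 'k::{real_normed_field,real_inner}" and P Q \<alpha> \<beta> M :: real
  assumes P: "0 \<le> P" and Q: "0 \<le> Q" "Q \<le> 1 / 2" and \<alpha>: "1 / 2 \<le> \<alpha>" "\<alpha> \<le> 1 - Q"
    and \<beta>: "\<beta> = 3 / 2 - P - Q - \<alpha>" "\<beta> > 0" and M: "M \<ge> 0"
    and bound: "\<And>c d w z. (\<And>i. norm (c i) \<le> 1) \<Longrightarrow> (\<And>j. norm (d j) \<le> 1) \<Longrightarrow>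
      (\<And>i. w i \<ge> 0) \<Longrightarrow> (\<And>j. z j \<ge> 0) \<Longrightarrow>
      norm (\<Sum>i<n. \<Sum>j<n. c i * of_real (w i powr P) * u i j * (d j * of_real (z j powr Q)))
        \<le> M * (\<Sum>i<n. w i) powr P * (\<Sum>j<n. z j) powr Q"
  shows "(\<Sum>i<n. (\<Sum>j<n. norm (u i j) powr (1 / \<alpha>)) powr (\<alpha> / \<beta>)) powr \<beta> \<le> 2 * M"
proof -
  define \<tau> where "\<tau> = (\<lambda>i. \<Sum>j<n. norm (u i j) powr (1 / \<alpha>))"
  define w where "w = (\<lambda>i. \<tau> i powr (\<alpha> / \<beta>))"
  define W where "W = (\<Sum>i<n. w i)"
  define \<gamma> where "\<gamma> = \<beta> + P"
  have \<gamma>: "\<gamma> = 3 / 2 - Q - \<alpha>" "\<gamma> > 0" and \<alpha>0: "\<alpha> > 0" using \<beta> P \<alpha> by (auto simp: \<gamma>_def)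
  have \<tau>0: "\<tau> i \<ge> 0" and w0: "w i \<ge> 0" for i
    by (simp_all add: \<tau>_def w_def sum_nonneg)
  have W0: "W \<ge> 0" using w0 by (simp add: W_def sum_nonneg)
  have w_eq: "(\<Sum>j<n. norm (of_real (w i powr P) * u i j) powr (1 / \<alpha>)) powr (\<alpha> / \<gamma>) = w i" for i
  proof -
    have "(\<Sum>j<n. norm (of_real (w i powr P) * u i j) powr (1 / \<alpha>)) = w i powr (P / \<alpha>) * \<tau> i"
      by (simp add: norm_mult powr_mult powr_powr \<tau>_def sum_distrib_left)
    then have "(\<Sum>j<n. norm (of_real (w i powr P) * u i j) powr (1 / \<alpha>)) powr (\<alpha> / \<gamma>)
        = w i powr (P / \<gamma>) * \<tau> i powr (\<alpha> / \<gamma>)"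
      using \<tau>0[of i] \<alpha>0 by (simp add: powr_mult powr_powr)
    also have "\<dots> = \<tau> i powr (\<alpha> / \<beta> * (P / \<gamma>) + \<alpha> / \<gamma>)"
      by (simp add: w_def powr_powr powr_add)
    also have "\<alpha> / \<beta> * (P / \<gamma>) + \<alpha> / \<gamma> = \<alpha> / \<beta> * ((P + \<beta>) / \<gamma>)"
      using \<beta>(2) by (simp add: add_divide_distrib distrib_left)
    also have "(P + \<beta>) / \<gamma> = 1"
      using \<gamma>(2) by (simp add: \<gamma>_def)
    finally show ?thesis by (simp add: w_def)
  qed
  have "(\<Sum>i<n. (\<Sum>j<n. norm (of_real (w i powr P) * u i j) powr (1 / \<alpha>)) powr (\<alpha> / \<gamma>)) powr \<gamma>
      \<le> 2 * (M * W powr P)"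
    unfolding W_def
    by (rule mixed_inequality_sup[OF Q \<alpha> \<gamma>(1)])
       (use M bound w0 in \<open>auto simp: mult.assoc[symmetric]\<close>)
  then have le: "W powr \<gamma> \<le> 2 * (M * W powr P)"
    unfolding w_eq W_def .
  have "W powr \<beta> \<le> 2 * M"
  proof (cases "W = 0")
    case False
    then have "W powr \<beta> * W powr P \<le> 2 * M * W powr P"
      using le by (simp add: \<gamma>_def powr_add mult.assoc)
    then show ?thesis using False W0 by simp
  qed (use M in simp)
  then show ?thesis by (simp add: W_def w_def \<tau>_def)
qed

section \<open>Forms on finite-dimensional sequence spaces\<close>

definition reciprocal :: "ereal \<Rightarrow> real \<Rightarrow> bool" where
  "reciprocal p P \<longleftrightarrow> p = \<infinity> \<and> P = 0 \<or> (\<exists>r>0. p = ereal r \<and> P = 1 / r)"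

lemma ereal_reciprocal:
  fixes p :: ereal
  assumes "2 \<le> p"
  obtains P where "1 / p = ereal P" "0 \<le> P" "P \<le> 1 / 2"
    "reciprocal p P"
proof (cases p)
  case (real r)
  then have "r \<ge> 2" using assms by simp
  then show ?thesis using that[of "1 / r"] real by (auto simp: reciprocal_def one_ereal_def field_simps)
next
  case PInf
  then show ?thesis using that[of 0] by (simp add: reciprocal_def)
qed (use assms in auto)

lemma lp_norm_le:
  fixes x :: "nat \<Rightarrow> 'k::real_normed_field"
  assumes p: "reciprocal p P"
    and n: "n \<ge> 1" and w: "\<And>i. w i \<ge> 0" and x: "\<And>i. i < n \<Longrightarrow> norm (x i) \<le> w i powr P"
  shows "lp_norm p n x \<le> (\<Sum>i<n. w i) powr P"
  using p unfolding reciprocal_def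
proof
  assume p: "p = \<infinity> \<and> P = 0"
  have "norm (x i) \<le> (\<Sum>i<n. w i) powr 0" if "i < n" for i
  proof (cases "w i = 0")
    case False
    have "w i \<le> (\<Sum>i<n. w i)"
      using that w by (intro member_le_sum) auto
    then show ?thesis
      using x[OF that] False w[of i] p by auto
  qed (use x[OF that] in auto)
  then show ?thesis
    using p n by (simp add: lp_norm_def Max_le_iff lessThan_empty_iff)
next
  assume "\<exists>r>0. p = ereal r \<and> P = 1 / r"
  then obtain r where r: "r > 0" "p = ereal r" "P = 1 / r" by blast
  have "(\<Sum>i<n. norm (x i) powr r) \<le> (\<Sum>i<n. w i)"
  proof (rule sum_mono)
    fix i assume "i \<in> {..<n}"
    then have "norm (x i) powr r \<le> (w i powr P) powr r"
      using x r by (intro powr_mono2) auto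
    then show "norm (x i) powr r \<le> w i"
      using w[of i] r by (simp add: powr_powr)
  qed
  then show ?thesis
    using r by (simp add: lp_norm_def powr_mono2 sum_nonneg)
qed

lemma lp_norm_le_1D:
  fixes x :: "nat \<Rightarrow> 'k::real_normed_field"
  assumes p: "reciprocal p P"
    and n: "n \<ge> 1" and x: "lp_norm p n x \<le> 1"
  obtains w where "\<And>i. w i \<ge> 0" "(\<Sum>i<n. w i) \<le> 1" "\<And>i. i < n \<Longrightarrow> norm (x i) \<le> w i powr P"
  using p unfolding reciprocal_def
proof
  assume p: "p = \<infinity> \<and> P = 0"
  have "norm (x i) \<le> 1" if "i < n" for i
  proof -
    have "norm (x i) \<le> Max ((\<lambda>i. norm (x i)) ` {..<n})"
      using that by (intro Max_ge) auto
    then show ?thesis using x p by (simp add: lp_norm_def)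
  qed
  then show ?thesis
    using that[of "\<lambda>_. 1 / real n"] p n by simp
next
  assume "\<exists>r>0. p = ereal r \<and> P = 1 / r"
  then obtain r where r: "r > 0" "p = ereal r" "P = 1 / r" by blast
  have "(\<Sum>i<n. norm (x i) powr r) powr (1 / r) \<le> 1"
    using x r by (simp add: lp_norm_def)
  then have "((\<Sum>i<n. norm (x i) powr r) powr (1 / r)) powr r \<le> 1 powr r"
    using r by (intro powr_mono2) auto
  then have "(\<Sum>i<n. norm (x i) powr r) \<le> 1"
    using r by (simp add: powr_powr sum_nonneg)
  then show ?thesis
    using that[of "\<lambda>i. norm (x i) powr r"] r by (simp add: powr_powr)
qed

definition matrix_form ::
    "nat \<Rightarrow> (nat \<Rightarrow> nat \<Rightarrow> 'k) \<Rightarrow> (nat \<Rightarrow> 'k::real_normed_field) \<Rightarrow> (nat \<Rightarrow> 'k) \<Rightarrow> 'k" where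
  "matrix_form n u x y = (\<Sum>i<n. \<Sum>j<n. x i * u i j * y j)"

lemma bilinear_matrix_form: "bilinear_form n (matrix_form n u)"
  by (simp add: bilinear_form_def matrix_form_def algebra_simps sum.distrib sum_distrib_left)

lemma matrix_form_unit_vector:
  assumes "i < n" "j < n"
  shows "matrix_form n u (unit_vector i) (unit_vector j) = u i j"
proof -
  have "matrix_form n u (unit_vector i) (unit_vector j)
      = (\<Sum>i'<n. \<Sum>j'<n. if j' = j then if i' = i then u i j else 0 else 0)"
    unfolding matrix_form_def unit_vector_def by (intro sum.cong) auto
  then show ?thesis using assms by simp
qed

lemma linear_on_vecs_expand:
  fixes L :: "(nat \<Rightarrow> 'k::real_normed_field) \<Rightarrow> 'k"
  assumes add: "\<And>x x'. x \<in> vecs n \<Longrightarrow> x' \<in> vecs n \<Longrightarrow> L (\<lambda>i. x i + x' i) = L x + L x'"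
    and mult: "\<And>c x. x \<in> vecs n \<Longrightarrow> L (\<lambda>i. c * x i) = c * L x"
    and x: "x \<in> vecs n"
  shows "L x = (\<Sum>i<n. x i * L (unit_vector i))"
proof -
  have "L (\<lambda>i. if i < m then x i else 0) = (\<Sum>i<m. x i * L (unit_vector i))" if "m \<le> n" for m
    using that
  proof (induction m)
    case 0
    show ?case using mult[of "\<lambda>_. 0" 0] by (simp add: vecs_def)
  next
    case (Suc m)
    have u: "unit_vector m \<in> vecs n" using Suc.prems by (simp add: vecs_def unit_vector_def)
    then have "(\<lambda>i. x m * unit_vector m i) \<in> vecs n" by (auto simp: vecs_def)
    moreover have "(\<lambda>i. if i < m then x i else 0) \<in> vecs n"
      using Suc.prems by (simp add: vecs_def)
    moreover have "(\<lambda>i. if i < Suc m then x i else 0)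
        = (\<lambda>i. (if i < m then x i else 0) + x m * unit_vector m i)"
      by (auto simp: unit_vector_def less_Suc_eq)
    ultimately show ?case
      using Suc add mult[OF u] by simp
  qed
  moreover have "(\<lambda>i. if i < n then x i else 0) = x"
    using x by (auto simp: vecs_def)
  ultimately show ?thesis by (metis order.refl)
qed

lemma bilinear_form_expand:
  assumes U: "bilinear_form n U" and x: "x \<in> vecs n" and y: "y \<in> vecs n"
  shows "U x y = matrix_form n (\<lambda>i j. U (unit_vector i) (unit_vector j)) x y"
proof -
  have e: "unit_vector i \<in> vecs n" if "i < n" for i
    using that by (simp add: vecs_def unit_vector_def)
  have "U x y = (\<Sum>i<n. x i * U (unit_vector i) y)"
    using U x y unfolding bilinear_form_def by (intro linear_on_vecs_expand) auto
  also have "\<dots> = (\<Sum>i<n. x i * (\<Sum>j<n. y j * U (unit_vector i) (unit_vector j)))"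
  proof (rule sum.cong)
    fix i assume "i \<in> {..<n}"
    then have "U (unit_vector i) y = (\<Sum>j<n. y j * U (unit_vector i) (unit_vector j))"
      using U e[of i] y unfolding bilinear_form_def by (intro linear_on_vecs_expand) auto
    then show "x i * U (unit_vector i) y = x i * (\<Sum>j<n. y j * U (unit_vector i) (unit_vector j))"
      by simp
  qed simp
  finally show ?thesis
    by (simp add: matrix_form_def sum_distrib_left mult_ac)
qed

lemma lp_norm_zero:
  "reciprocal p P \<Longrightarrow> n \<ge> 1 \<Longrightarrow> lp_norm p n (\<lambda>_. 0 :: 'k::real_normed_field) \<le> 1"
  using lp_norm_le[of p P n "\<lambda>_. 0" "\<lambda>_. 0 :: 'k"] by simp

lemma form_norm_le:
  fixes U :: "(nat \<Rightarrow> 'k::real_normed_field) \<Rightarrow> (nat \<Rightarrow> 'k) \<Rightarrow> 'k"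
  assumes p: "reciprocal p P" and q: "reciprocal q Q" and n: "n \<ge> 1"
    and K: "\<And>x y w z. (\<And>i. w i \<ge> 0) \<Longrightarrow> (\<And>j. z j \<ge> 0) \<Longrightarrow> (\<Sum>i<n. w i) \<le> 1 \<Longrightarrow> (\<Sum>j<n. z j) \<le> 1 \<Longrightarrow>
      (\<And>i. i < n \<Longrightarrow> norm (x i) \<le> w i powr P) \<Longrightarrow> (\<And>j. j < n \<Longrightarrow> norm (y j) \<le> z j powr Q) \<Longrightarrow>
      norm (U x y) \<le> K"
  shows "form_norm p q n U \<le> K"
  unfolding form_norm_def
proof (rule cSup_least)
  show "{norm (U x y) |x y. x \<in> vecs n \<and> y \<in> vecs n \<and> lp_norm p n x \<le> 1 \<and> lp_norm q n y \<le> 1} \<noteq> {}"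
    using lp_norm_zero[OF p n] lp_norm_zero[OF q n] by (fastforce simp: vecs_def)
next
  fix t
  assume "t \<in> {norm (U x y) |x y. x \<in> vecs n \<and> y \<in> vecs n \<and> lp_norm p n x \<le> 1 \<and> lp_norm q n y \<le> 1}"
  then obtain x y where t: "t = norm (U x y)" and xy: "lp_norm p n x \<le> 1" "lp_norm q n y \<le> 1"
    by blast
  obtain w where w: "\<And>i. w i \<ge> 0" "(\<Sum>i<n. w i) \<le> 1" "\<And>i. i < n \<Longrightarrow> norm (x i) \<le> w i powr P"
    using lp_norm_le_1D[OF p n xy(1)] by blast
  obtain z where z: "\<And>i. z i \<ge> 0" "(\<Sum>i<n. z i) \<le> 1" "\<And>i. i < n \<Longrightarrow> norm (y i) \<le> z i powr Q"
    using lp_norm_le_1D[OF q n xy(2)] by blast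
  show "t \<le> K"
    unfolding t using w z by (intro K[of w z])
qed

lemma norm_le_form_norm:
  fixes U :: "(nat \<Rightarrow> 'k::real_normed_field) \<Rightarrow> (nat \<Rightarrow> 'k) \<Rightarrow> 'k"
  assumes p: "reciprocal p P" "P \<ge> 0" and q: "reciprocal q Q" "Q \<ge> 0" and n: "n \<ge> 1"
    and U: "bilinear_form n U" and x: "x \<in> vecs n" "lp_norm p n x \<le> 1"
    and y: "y \<in> vecs n" "lp_norm q n y \<le> 1"
  shows "norm (U x y) \<le> form_norm p q n U"
  unfolding form_norm_def
proof (rule cSup_upper)
  let ?u = "\<lambda>i j. U (unit_vector i) (unit_vector j)"
  have le1: "norm (x i) \<le> 1" if x: "lp_norm p n x \<le> 1" and i: "i < n" and p: "reciprocal p P" "P \<ge> 0"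
    for p P i and x :: "nat \<Rightarrow> 'k"
  proof -
    obtain w where w: "\<And>i. w i \<ge> 0" "(\<Sum>i<n. w i) \<le> 1" "\<And>i. i < n \<Longrightarrow> norm (x i) \<le> w i powr P"
      using lp_norm_le_1D[OF p(1) n x] by blast
    have "w i \<le> (\<Sum>i<n. w i)"
      using w i by (intro member_le_sum) auto
    then have "w i powr P \<le> 1"
      using w p by (intro powr_le1) (auto intro: order.trans)
    then show ?thesis using w(3)[OF i] by simp
  qed
  show "bdd_above {norm (U x y) |x y. x \<in> vecs n \<and> y \<in> vecs n \<and> lp_norm p n x \<le> 1 \<and> lp_norm q n y \<le> 1}"
  proof (rule bdd_aboveI)
    fix t
    assume "t \<in> {norm (U x y) |x y. x \<in> vecs n \<and> y \<in> vecs n \<and> lp_norm p n x \<le> 1 \<and> lp_norm q n y \<le> 1}"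
    then obtain x y where t: "t = norm (U x y)" and v: "x \<in> vecs n" "y \<in> vecs n"
      and xy: "lp_norm p n x \<le> 1" "lp_norm q n y \<le> 1"
      by blast
    have "norm (x i * ?u i j * y j) \<le> norm (?u i j)" if "i < n" "j < n" for i j
    proof -
      have "norm (x i) * norm (y j) \<le> 1"
        using mult_mono[OF le1[OF xy(1) that(1) p] le1[OF xy(2) that(2) q]] by simp
      then have "norm (x i) * norm (y j) * norm (?u i j) \<le> 1 * norm (?u i j)"
        by (intro mult_right_mono) auto
      then show ?thesis by (simp add: norm_mult mult_ac)
    qed
    then show "t \<le> (\<Sum>i<n. \<Sum>j<n. norm (?u i j))"
      unfolding t bilinear_form_expand[OF U v] matrix_form_def
      by (intro order.trans[OF norm_sum] sum_mono) auto
  qed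
qed (use x y in blast)

lemma scaled_form_le_form_norm:
  fixes U :: "(nat \<Rightarrow> 'k::real_normed_field) \<Rightarrow> (nat \<Rightarrow> 'k) \<Rightarrow> 'k"
  assumes p: "reciprocal p P" "P \<ge> 0" and q: "reciprocal q Q" "Q \<ge> 0" and n: "n \<ge> 1"
    and U: "bilinear_form n U"
    and c: "\<And>i. norm (c i) \<le> 1" and d: "\<And>j. norm (d j) \<le> 1"
    and w: "\<And>i. w i \<ge> 0" and z: "\<And>j. z j \<ge> 0"
  shows "norm (\<Sum>i<n. \<Sum>j<n. c i * of_real (w i powr P) * U (unit_vector i) (unit_vector j)
      * (d j * of_real (z j powr Q)))
    \<le> form_norm p q n U * (\<Sum>i<n. w i) powr P * (\<Sum>j<n. z j) powr Q"
    (is "norm ?S \<le> _")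
proof -
  let ?W = "\<Sum>i<n. w i" and ?Z = "\<Sum>j<n. z j"
  have W0: "?W \<ge> 0" and Z0: "?Z \<ge> 0" using w z by (auto intro: sum_nonneg)
  show ?thesis
  proof (cases "?W = 0 \<or> ?Z = 0")
    case True
    then have "(\<forall>i<n. w i = 0) \<or> (\<forall>j<n. z j = 0)"
      using w z by (auto simp: sum_nonneg_eq_0_iff)
    then have "?S = 0" by auto
    then show ?thesis using True by auto
  next
    case False
    then have W: "?W > 0" and Z: "?Z > 0" using W0 Z0 by auto
    define x where "x = (\<lambda>i. if i < n then c i * of_real ((w i / ?W) powr P) else 0)"
    define y where "y = (\<lambda>j. if j < n then d j * of_real ((z j / ?Z) powr Q) else 0)"
    have "lp_norm p n x \<le> (\<Sum>i<n. w i / ?W) powr P"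
      using w c W by (intro lp_norm_le[OF p(1) n]) (auto simp: x_def norm_mult mult_left_le_one_le)
    then have x: "lp_norm p n x \<le> 1"
      using W by (simp add: sum_divide_distrib[symmetric])
    have "lp_norm q n y \<le> (\<Sum>j<n. z j / ?Z) powr Q"
      using z d Z by (intro lp_norm_le[OF q(1) n]) (auto simp: y_def norm_mult mult_left_le_one_le)
    then have y: "lp_norm q n y \<le> 1"
      using Z by (simp add: sum_divide_distrib[symmetric])
    have v: "x \<in> vecs n" "y \<in> vecs n" by (auto simp: x_def y_def vecs_def)
    have "?S = of_real (?W powr P * ?Z powr Q) * U x y"
      unfolding bilinear_form_expand[OF U v] matrix_form_def sum_distrib_left
    proof (intro sum.cong refl)
      fix i j assume "i \<in> {..<n}" "j \<in> {..<n}"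
      then show "c i * of_real (w i powr P) * U (unit_vector i) (unit_vector j) * (d j * of_real (z j powr Q))
          = of_real (?W powr P * ?Z powr Q) * (x i * U (unit_vector i) (unit_vector j) * y j)"
        using W Z w z by (simp add: x_def y_def powr_divide)
    qed
    then have "norm ?S = ?W powr P * ?Z powr Q * norm (U x y)"
      by (simp add: norm_mult)
    also have "\<dots> \<le> ?W powr P * ?Z powr Q * form_norm p q n U"
      using norm_le_form_norm[OF p q n U v(1) x v(2) y] by (intro mult_left_mono) auto
    finally show ?thesis by (simp add: mult_ac)
  qed
qed

lemma mixed_sum_le_form_norm:
  fixes U :: "(nat \<Rightarrow> 'k::{real_normed_field,real_inner}) \<Rightarrow> (nat \<Rightarrow> 'k) \<Rightarrow> 'k"
  assumes p: "reciprocal p P" "P \<ge> 0" and q: "reciprocal q Q" "0 \<le> Q" "Q \<le> 1 / 2"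
    and ab: "a > 0" "b > 0" "1 / a \<le> 1 - Q" "1 / b \<le> 1 - P - Q" "1 / a + 1 / b \<le> 3 / 2 - P - Q"
    and n: "n \<ge> 1" and U: "bilinear_form n U"
  shows "mixed_sum a b n U \<le> 2 * form_norm p q n U"
proof -
  let ?u = "\<lambda>i j. norm (U (unit_vector i) (unit_vector j))"
  define \<alpha> where "\<alpha> = max (1 / a) (1 / 2)"
  define \<beta> where "\<beta> = 3 / 2 - P - Q - \<alpha>"
  have \<alpha>: "1 / 2 \<le> \<alpha>" "\<alpha> \<le> 1 - Q" "1 / a \<le> \<alpha>" and \<beta>: "1 / b \<le> \<beta>"
    using ab q by (auto simp: \<alpha>_def \<beta>_def)
  have pos: "\<alpha> > 0" "\<beta> > 0"
    using \<alpha> \<beta> ab by (auto intro: less_le_trans[of _ "1 / b"])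
  have exps: "1 / \<alpha> \<le> a" "1 / \<beta> \<le> b" "1 / \<alpha> > 0" "1 / \<beta> > 0"
    using \<alpha> \<beta> pos ab by (auto simp: field_simps)
  have "norm (U (\<lambda>_. 0) (\<lambda>_. 0)) \<le> form_norm p q n U"
    using lp_norm_zero[OF p(1) n] lp_norm_zero[OF q(1) n]
    by (intro norm_le_form_norm[OF p q(1,2) n U]) (auto simp: vecs_def)
  then have M: "form_norm p q n U \<ge> 0"
    using norm_ge_zero order.trans by blast
  let ?T = "\<lambda>i. (\<Sum>j<n. ?u i j powr (1 / \<alpha>)) powr \<alpha>"
  have "mixed_sum a b n U = (\<Sum>i<n. ((\<Sum>j<n. ?u i j powr a) powr (1 / a)) powr b) powr (1 / b)"
    by (simp add: mixed_sum_def powr_powr)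
  also have "\<dots> \<le> (\<Sum>i<n. ?T i powr b) powr (1 / b)"
  proof (intro powr_mono2 sum_mono sum_nonneg)
    show "(\<Sum>j<n. ?u i j powr a) powr (1 / a) \<le> ?T i" for i
      using sum_powr_mono_exponent[of "{..<n}" "?u i" "1 / \<alpha>" a] exps by simp
  qed (use ab in auto)
  also have "\<dots> \<le> (\<Sum>i<n. ?T i powr (1 / \<beta>)) powr \<beta>"
    using sum_powr_mono_exponent[of "{..<n}" ?T "1 / \<beta>" b] exps by simp
  also have "\<dots> \<le> 2 * form_norm p q n U"
    using mixed_inequality_core[OF p(2) q(2,3) \<alpha>(1,2) \<beta>_def pos(2) M
        scaled_form_le_form_norm[OF p q(1,2) n U]]
    by (simp add: powr_powr)
  finally show ?thesis .
qed

section \<open>Test forms\<close>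

lemma exists_orthogonal_sign_matrix:
  "\<exists>h :: nat \<Rightarrow> nat \<Rightarrow> real. (\<forall>i j. \<bar>h i j\<bar> = 1) \<and>
    (\<forall>x :: nat \<Rightarrow> 'a::real_inner.
      (\<Sum>i<2^k. (norm (\<Sum>j<2^k. h i j *\<^sub>R x j))\<^sup>2) = 2^k * (\<Sum>j<2^k. (norm (x j))\<^sup>2))"
proof (induction k)
  case 0
  show ?case by (rule exI[of _ "\<lambda>_ _. 1"]) simp
next
  case (Suc k)
  let ?N = "2 ^ k :: nat"
  obtain h :: "nat \<Rightarrow> nat \<Rightarrow> real" where h1: "\<And>i j. \<bar>h i j\<bar> = 1"
    and h: "\<And>x :: nat \<Rightarrow> 'a. (\<Sum>i<?N. (norm (\<Sum>j<?N. h i j *\<^sub>R x j))\<^sup>2) = 2^k * (\<Sum>j<?N. (norm (x j))\<^sup>2)"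
    using Suc.IH by blast
  define H where "H = (\<lambda>i j. (if i \<ge> ?N \<and> j \<ge> ?N then -1 else 1) * h (i mod ?N) (j mod ?N))"
  have split: "(\<Sum>i<2 ^ Suc k. f i) = (\<Sum>i<?N. f i) + (\<Sum>i<?N. f (?N + i))"
    for f :: "nat \<Rightarrow> 'c::comm_monoid_add"
  proof -
    have "(\<Sum>i<?N + m. f i) = (\<Sum>i<?N. f i) + (\<Sum>i<m. f (?N + i))" for m
      by (induction m) (simp_all add: add_ac)
    from this[of ?N] show ?thesis by (simp add: mult_2)
  qed
  have "(\<Sum>i<2 ^ Suc k. (norm (\<Sum>j<2 ^ Suc k. H i j *\<^sub>R x j))\<^sup>2) = 2 ^ Suc k * (\<Sum>j<2 ^ Suc k. (norm (x j))\<^sup>2)"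
    for x :: "nat \<Rightarrow> 'a"
  proof -
    let ?a = "\<lambda>i. \<Sum>j<?N. h i j *\<^sub>R x j" and ?b = "\<lambda>i. \<Sum>j<?N. h i j *\<^sub>R x (?N + j)"
    have "(\<Sum>i<2 ^ Suc k. (norm (\<Sum>j<2 ^ Suc k. H i j *\<^sub>R x j))\<^sup>2)
        = (\<Sum>i<?N. (norm (?a i + ?b i))\<^sup>2) + (\<Sum>i<?N. (norm (?a i - ?b i))\<^sup>2)"
      unfolding split by (simp add: H_def sum_negf)
    also have "\<dots> = (\<Sum>i<?N. 2 * ((norm (?a i))\<^sup>2 + (norm (?b i))\<^sup>2))"
      by (subst sum.distrib[symmetric]) (simp only: norm_power2_parallelogram)
    also have "\<dots> = 2 ^ Suc k * (\<Sum>j<2 ^ Suc k. (norm (x j))\<^sup>2)"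
      unfolding split by (simp only: sum_distrib_left[symmetric] sum.distrib h) (simp add: algebra_simps)
    finally show ?thesis .
  qed
  moreover have "\<bar>H i j\<bar> = 1" for i j
    by (simp add: H_def h1 abs_mult)
  ultimately show ?case by blast
qed

lemma powr_growth_exponent_le:
  fixes s t C :: real
  assumes "\<And>k::nat. real (2 ^ k) powr s \<le> C * real (2 ^ k) powr t"
  shows "s \<le> t"
proof (rule ccontr)
  assume "\<not> s \<le> t"
  then have "2 powr (s - t) > (1::real)" by simp
  then obtain k where k: "C < (2 powr (s - t)) ^ k"
    using real_arch_pow by blast
  have "real (2 ^ k) powr (s - t) \<le> C"
    using assms[of k] by (simp add: powr_diff divide_le_eq)
  moreover have "real (2 ^ k) powr (s - t) = (2 powr (s - t)) ^ k"
    by (simp add: powr_realpow[symmetric] powr_powr mult.commute)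
  ultimately show False using k by simp
qed

lemma sum_powr_le_1:
  fixes w :: "'i \<Rightarrow> real"
  assumes "\<And>i. w i \<ge> 0" "(\<Sum>i\<in>A. w i) \<le> 1" "P \<ge> 0"
  shows "(\<Sum>i\<in>A. w i) powr P \<le> 1"
  using assms powr_mono2[of P "\<Sum>i\<in>A. w i" 1] by (simp add: sum_nonneg)

lemma sum_square_powr_le:
  fixes x :: "nat \<Rightarrow> 'k::real_normed_vector"
  assumes w: "\<And>i. w i \<ge> 0" "(\<Sum>i<n. w i) \<le> 1" and P: "0 \<le> P" "P \<le> 1 / 2"
    and x: "\<And>i. i < n \<Longrightarrow> norm (x i) \<le> w i powr P"
  shows "(\<Sum>i<n. (norm (x i))\<^sup>2) \<le> real n powr (1 - 2 * P)"
proof -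
  have "(\<Sum>i<n. (norm (x i))\<^sup>2) \<le> (\<Sum>i<n. (w i powr P)\<^sup>2)"
    using x by (intro sum_mono power_mono) auto
  also have "\<dots> = (\<Sum>i<n. w i powr (2 * P) * 1 powr (1 - 2 * P))"
    by (simp add: power2_eq_square powr_add[symmetric])
  also have "\<dots> \<le> (\<Sum>i<n. w i) powr (2 * P) * (\<Sum>i<n. 1) powr (1 - 2 * P)"
    using w P by (intro Holder_sum2) auto
  also have "\<dots> \<le> 1 * real n powr (1 - 2 * P)"
    using w P by (intro mult_mono sum_powr_le_1) auto
  finally show ?thesis by simp
qed

lemma admissible_if_bounded:
  fixes p q :: ereal and a b C :: real
  assumes p: "reciprocal p P" "0 \<le> P" "P \<le> 1 / 2" and q: "reciprocal q Q" "0 \<le> Q" "Q \<le> 1 / 2"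
    and PQ: "P + Q < 1" and ab: "a > 0" "b > 0" and C: "C \<ge> 0"
    and bounded: "\<And>n (U :: (nat \<Rightarrow> 'k::{real_normed_field,real_inner}) \<Rightarrow> (nat \<Rightarrow> 'k) \<Rightarrow> 'k).
      n \<ge> 1 \<Longrightarrow> bilinear_form n U \<Longrightarrow> mixed_sum a b n U \<le> C * form_norm p q n U"
  shows "1 / a \<le> 1 - Q \<and> 1 / b \<le> 1 - P - Q \<and> 1 / a + 1 / b \<le> 3 / 2 - P - Q"
proof -
  have test: "s \<le> t"
    if mixed: "\<And>k. mixed_sum a b (2 ^ k) (matrix_form (2 ^ k) (u k)) = real (2 ^ k) powr s"
      and bound: "\<And>k x y w z. (\<And>i. w i \<ge> 0) \<Longrightarrow> (\<And>j. z j \<ge> 0) \<Longrightarrow>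
        (\<Sum>i<2^k. w i) \<le> 1 \<Longrightarrow> (\<Sum>j<2^k. z j) \<le> 1 \<Longrightarrow>
        (\<And>i. i < 2^k \<Longrightarrow> norm (x i) \<le> w i powr P) \<Longrightarrow> (\<And>j. j < 2^k \<Longrightarrow> norm (y j) \<le> z j powr Q) \<Longrightarrow>
        norm (matrix_form (2 ^ k) (u k) x y) \<le> real (2 ^ k) powr t"
    for u :: "nat \<Rightarrow> nat \<Rightarrow> nat \<Rightarrow> 'k" and s t
  proof (rule powr_growth_exponent_le)
    fix k :: nat
    have "real (2 ^ k) powr s \<le> C * form_norm p q (2 ^ k) (matrix_form (2 ^ k) (u k))"
      unfolding mixed[symmetric] by (intro bounded bilinear_matrix_form) simp
    also have "\<dots> \<le> C * real (2 ^ k) powr t"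
    proof (rule mult_left_mono[OF _ C])
      show "form_norm p q (2 ^ k) (matrix_form (2 ^ k) (u k)) \<le> real (2 ^ k) powr t"
      proof (rule form_norm_le[OF p(1) q(1)])
        fix x y :: "nat \<Rightarrow> 'k" and w z :: "nat \<Rightarrow> real"
        assume "\<And>i. w i \<ge> 0" "\<And>j. z j \<ge> 0" "(\<Sum>i<2^k. w i) \<le> 1" "(\<Sum>j<2^k. z j) \<le> 1"
          "\<And>i. i < 2^k \<Longrightarrow> norm (x i) \<le> w i powr P" "\<And>j. j < 2^k \<Longrightarrow> norm (y j) \<le> z j powr Q"
        then show "norm (matrix_form (2 ^ k) (u k) x y) \<le> real (2 ^ k) powr t"
          by (intro bound[of w z])
      qed simp
    qed
    finally show "real (2 ^ k) powr s \<le> C * real (2 ^ k) powr t" .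
  qed
  have mixed_eq: "mixed_sum a b n (matrix_form n u)
      = (\<Sum>i<n. (\<Sum>j<n. norm (u i j) powr a) powr (1 / a * b)) powr (1 / b)" for n and u :: "nat \<Rightarrow> nat \<Rightarrow> 'k"
    by (simp add: mixed_sum_def matrix_form_unit_vector)

  have "1 / a \<le> 1 - Q"
  proof (rule test[of "\<lambda>_ i j. if i = 0 then 1 else 0"])
    fix k :: nat
    let ?n = "2 ^ k :: nat"
    have "(\<Sum>j<?n. norm (if i = 0 then 1 else 0 :: 'k) powr a) powr (1 / a * b)
        = (if i = 0 then real ?n powr (1 / a * b) else 0)" for i :: nat
      by simp
    then show "mixed_sum a b ?n (matrix_form ?n (\<lambda>i j. if i = 0 then 1 else 0 :: 'k)) = real ?n powr (1 / a)"
      unfolding mixed_eq using ab by (simp add: powr_powr)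
    fix x y :: "nat \<Rightarrow> 'k" and w z :: "nat \<Rightarrow> real"
    assume w: "\<And>i. w i \<ge> 0" "(\<Sum>i<?n. w i) \<le> 1" "\<And>i. i < ?n \<Longrightarrow> norm (x i) \<le> w i powr P"
      and z: "\<And>j. z j \<ge> 0" "(\<Sum>j<?n. z j) \<le> 1" "\<And>j. j < ?n \<Longrightarrow> norm (y j) \<le> z j powr Q"
    have "w 0 \<le> (\<Sum>i<?n. w i)" using w by (intro member_le_sum) auto
    then have "w 0 powr P \<le> 1" using w p by (intro powr_le1) auto
    then have x0: "norm (x 0) \<le> 1" using w(3)[of 0] by simp
    have "matrix_form ?n (\<lambda>i j. if i = 0 then 1 else 0) x y = (\<Sum>i<?n. if i = 0 then x 0 * (\<Sum>j<?n. y j) else 0)"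
      unfolding matrix_form_def by (intro sum.cong) (auto simp: sum_distrib_left)
    then have "norm (matrix_form ?n (\<lambda>i j. if i = 0 then 1 else 0) x y) = norm (x 0) * norm (\<Sum>j<?n. y j)"
      by (simp add: norm_mult)
    also have "\<dots> \<le> 1 * (\<Sum>j<?n. z j powr Q * 1 powr (1 - Q))"
      using x0 z by (intro mult_mono order.trans[OF norm_sum] sum_mono) auto
    also have "\<dots> \<le> 1 * ((\<Sum>j<?n. z j) powr Q * (\<Sum>j<?n. 1) powr (1 - Q))"
      using q z by (intro mult_left_mono Holder_sum2) auto
    also have "\<dots> \<le> 1 * (1 * (\<Sum>j<?n. 1) powr (1 - Q))"
      using mult_right_mono[OF sum_powr_le_1[OF z(1,2) q(2)], of "(\<Sum>j<?n. 1) powr (1 - Q)"] by simp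
    finally show "norm (matrix_form ?n (\<lambda>i j. if i = 0 then 1 else 0) x y) \<le> real ?n powr (1 - Q)"
      by simp
  qed
  moreover have "1 / b \<le> 1 - P - Q"
  proof (rule test[of "\<lambda>_ i j. if j = i then 1 else 0"])
    fix k :: nat
    let ?n = "2 ^ k :: nat"
    have "(\<Sum>j<?n. norm (if j = i then 1 else 0 :: 'k) powr a) powr (1 / a * b) = 1" if "i < ?n" for i
    proof -
      have "(\<Sum>j<?n. norm (if j = i then 1 else 0 :: 'k) powr a) = (\<Sum>j<?n. if j = i then 1 else 0)"
        by (intro sum.cong) auto
      then show ?thesis using that by simp
    qed
    then show "mixed_sum a b ?n (matrix_form ?n (\<lambda>i j. if j = i then 1 else 0 :: 'k)) = real ?n powr (1 / b)"
      unfolding mixed_eq by simp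
    fix x y :: "nat \<Rightarrow> 'k" and w z :: "nat \<Rightarrow> real"
    assume w: "\<And>i. w i \<ge> 0" "(\<Sum>i<?n. w i) \<le> 1" "\<And>i. i < ?n \<Longrightarrow> norm (x i) \<le> w i powr P"
      and z: "\<And>j. z j \<ge> 0" "(\<Sum>j<?n. z j) \<le> 1" "\<And>j. j < ?n \<Longrightarrow> norm (y j) \<le> z j powr Q"
    have "matrix_form ?n (\<lambda>i j. if j = i then 1 else 0) x y
        = (\<Sum>i<?n. \<Sum>j<?n. if j = i then x i * y i else 0)"
      unfolding matrix_form_def by (intro sum.cong) auto
    also have "\<dots> = (\<Sum>i<?n. x i * y i)"
      by simp
    also have "norm \<dots> \<le> (\<Sum>i<?n. w i powr P * z i powr Q * 1 powr (1 - P - Q))"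
      using w z by (intro order.trans[OF norm_sum] sum_mono) (auto simp: norm_mult intro!: mult_mono)
    also have "\<dots> \<le> (\<Sum>i<?n. w i) powr P * (\<Sum>i<?n. z i) powr Q * (\<Sum>i<?n. 1) powr (1 - P - Q)"
      using p q w z PQ by (intro Holder_sum3) auto
    also have "\<dots> \<le> 1 * 1 * (\<Sum>i<?n. 1) powr (1 - P - Q)"
      by (intro mult_right_mono mult_mono sum_powr_le_1 w z p q) auto
    finally show "norm (matrix_form ?n (\<lambda>i j. if j = i then 1 else 0) x y) \<le> real ?n powr (1 - P - Q)"
      by simp
  qed
  moreover have "1 / a + 1 / b \<le> 3 / 2 - P - Q"
  proof -
    have "\<forall>k. \<exists>h :: nat \<Rightarrow> nat \<Rightarrow> real. (\<forall>i j. \<bar>h i j\<bar> = 1) \<and> (\<forall>x :: nat \<Rightarrow> 'k.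
        (\<Sum>i<2^k. (norm (\<Sum>j<2^k. h i j *\<^sub>R x j))\<^sup>2) = 2^k * (\<Sum>j<2^k. (norm (x j))\<^sup>2))"
      by (rule allI, rule exists_orthogonal_sign_matrix)
    from choice[OF this] obtain h :: "nat \<Rightarrow> nat \<Rightarrow> nat \<Rightarrow> real"
      where h1: "\<And>k i j. \<bar>h k i j\<bar> = 1"
      and h: "\<And>k (x :: nat \<Rightarrow> 'k).
        (\<Sum>i<2^k. (norm (\<Sum>j<2^k. h k i j *\<^sub>R x j))\<^sup>2) = 2^k * (\<Sum>j<2^k. (norm (x j))\<^sup>2)"
      by blast
    show ?thesis
    proof (rule test[of "\<lambda>k i j. of_real (h k j i)"])
      fix k :: nat
      let ?n = "2 ^ k :: nat"
      show "mixed_sum a b ?n (matrix_form ?n (\<lambda>i j. of_real (h k j i) :: 'k)) = real ?n powr (1 / a + 1 / b)"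
        unfolding mixed_eq using ab by (simp add: h1 powr_mult powr_powr powr_add)
      fix x y :: "nat \<Rightarrow> 'k" and w z :: "nat \<Rightarrow> real"
      assume w: "\<And>i. w i \<ge> 0" "(\<Sum>i<?n. w i) \<le> 1" "\<And>i. i < ?n \<Longrightarrow> norm (x i) \<le> w i powr P"
        and z: "\<And>j. z j \<ge> 0" "(\<Sum>j<?n. z j) \<le> 1" "\<And>j. j < ?n \<Longrightarrow> norm (y j) \<le> z j powr Q"
      let ?X = "\<lambda>j. \<Sum>i<?n. h k j i *\<^sub>R x i"
      let ?N = "real ?n"
      have "matrix_form ?n (\<lambda>i j. of_real (h k j i)) x y = (\<Sum>j<?n. ?X j * y j)"
        unfolding matrix_form_def
        by (subst sum.swap) (simp add: sum_distrib_left sum_distrib_right scaleR_conv_of_real mult_ac)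
      also have "norm \<dots> \<le> (\<Sum>j<?n. norm (?X j) * norm (y j))"
        by (intro order.trans[OF norm_sum] sum_mono) (simp add: norm_mult)
      finally have "(norm (matrix_form ?n (\<lambda>i j. of_real (h k j i)) x y))\<^sup>2
          \<le> (\<Sum>j<?n. norm (?X j) * norm (y j))\<^sup>2"
        by (intro power_mono) auto
      also have "\<dots> \<le> (\<Sum>j<?n. (norm (?X j))\<^sup>2) * (\<Sum>j<?n. (norm (y j))\<^sup>2)"
        by (rule Cauchy_Schwarz_ineq_sum)
      also have "\<dots> = ?N * (\<Sum>j<?n. (norm (x j))\<^sup>2) * (\<Sum>j<?n. (norm (y j))\<^sup>2)"
        unfolding h by simp
      also have "\<dots> \<le> ?N * ?N powr (1 - 2 * P) * ?N powr (1 - 2 * Q)"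
        using sum_square_powr_le[OF w(1,2) p(2,3) w(3)] sum_square_powr_le[OF z(1,2) q(2,3) z(3)]
        by (intro mult_mono mult_left_mono) (simp_all add: sum_nonneg)
      also have "\<dots> = ?N powr (1 + (1 - 2 * P) + (1 - 2 * Q))"
        by (simp only: powr_add) simp
      also have "\<dots> = (?N powr (3 / 2 - P - Q))\<^sup>2"
        unfolding power2_eq_square powr_add[symmetric] by (simp add: algebra_simps)
      finally show "norm (matrix_form ?n (\<lambda>i j. of_real (h k j i)) x y) \<le> ?N powr (3 / 2 - P - Q)"
        by (rule power2_le_imp_le) simp
    qed
  qed
  ultimately show ?thesis by blast
qed

lemma admissible_iff:
  assumes P: "1 / p = ereal P" and Q: "1 / q = ereal Q" and PQ: "P \<ge> 0" "P + Q < 1"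
    and ab: "a > 0" "b > 0"
  shows "admissible p q a b \<longleftrightarrow> 1 / a \<le> 1 - Q \<and> 1 / b \<le> 1 - P - Q \<and> 1 / a + 1 / b \<le> 3 / 2 - P - Q"
proof -
  have inv: "inverse t \<le> s \<longleftrightarrow> 1 / s \<le> t" if "t > 0" "s > 0" for s t :: real
    using that by (simp add: field_simps)
  have 1: "1 - 1 / q = ereal (1 - Q)" "1 - 1 / p - 1 / q = ereal (1 - P - Q)"
    unfolding P Q by (simp_all add: one_ereal_def)
  have 2: "3 / 2 - (1 / p + 1 / q) = ereal (3 / 2 - P - Q)"
    unfolding P Q by (simp add: numeral_eq_ereal)
  show ?thesis
    unfolding admissible_def 1 2 using PQ ab inv[of "1 - Q" a] inv[of "1 - P - Q" b] by simp
qed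

lemma bounded_iff_admissible:
  fixes p q :: ereal and a b :: real
  assumes "2 \<le> p" and "2 \<le> q" and "1 / p + 1 / q < 1" and ab: "a > 0" "b > 0"
  shows "(\<exists>C::real. C \<ge> 1 \<and>
         (\<forall>n\<ge>1. \<forall>U :: (nat \<Rightarrow> 'k::{real_normed_field,real_inner}) \<Rightarrow> (nat \<Rightarrow> 'k) \<Rightarrow> 'k.
            bilinear_form n U \<longrightarrow> mixed_sum a b n U \<le> C * form_norm p q n U))
      \<longleftrightarrow> admissible p q a b"
proof -
  obtain P where P: "1 / p = ereal P" "0 \<le> P" "P \<le> 1 / 2" "reciprocal p P"
    using ereal_reciprocal[OF assms(1)] by blast
  obtain Q where Q: "1 / q = ereal Q" "0 \<le> Q" "Q \<le> 1 / 2" "reciprocal q Q"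
    using ereal_reciprocal[OF assms(2)] by blast
  have PQ: "P + Q < 1" using assms(3) by (simp add: P Q)
  show ?thesis
    unfolding admissible_iff[OF P(1) Q(1) P(2) PQ ab]
  proof
    assume "\<exists>C::real. C \<ge> 1 \<and> (\<forall>n\<ge>1. \<forall>U :: (nat \<Rightarrow> 'k) \<Rightarrow> (nat \<Rightarrow> 'k) \<Rightarrow> 'k.
            bilinear_form n U \<longrightarrow> mixed_sum a b n U \<le> C * form_norm p q n U)"
    then obtain C :: real where "C \<ge> 1"
      and "\<And>n (U :: (nat \<Rightarrow> 'k) \<Rightarrow> (nat \<Rightarrow> 'k) \<Rightarrow> 'k). n \<ge> 1 \<Longrightarrow> bilinear_form n U
        \<Longrightarrow> mixed_sum a b n U \<le> C * form_norm p q n U"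
      by blast
    then show "1 / a \<le> 1 - Q \<and> 1 / b \<le> 1 - P - Q \<and> 1 / a + 1 / b \<le> 3 / 2 - P - Q"
      by (intro admissible_if_bounded[OF P(4,2,3) Q(4,2,3) PQ ab, of C]) auto
  next
    assume "1 / a \<le> 1 - Q \<and> 1 / b \<le> 1 - P - Q \<and> 1 / a + 1 / b \<le> 3 / 2 - P - Q"
    then have "mixed_sum a b n U \<le> 2 * form_norm p q n U"
      if "n \<ge> 1" "bilinear_form n U" for n and U :: "(nat \<Rightarrow> 'k) \<Rightarrow> (nat \<Rightarrow> 'k) \<Rightarrow> 'k"
      using that by (intro mixed_sum_le_form_norm[OF P(4,2) Q(4,2,3) ab]) auto
    then show "\<exists>C::real. C \<ge> 1 \<and> (\<forall>n\<ge>1. \<forall>U :: (nat \<Rightarrow> 'k) \<Rightarrow> (nat \<Rightarrow> 'k) \<Rightarrow> 'k.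
            bilinear_form n U \<longrightarrow> mixed_sum a b n U \<le> C * form_norm p q n U)"
      by (intro exI[of _ 2] conjI allI impI) simp_all
  qed
qed

theorem theorem5p1:
  fixes p q :: ereal and a b :: real
  assumes "2 \<le> p" and "2 \<le> q" and "1 / p + 1 / q < 1" and "a > 0" and "b > 0"
  shows
    "((\<exists>C::real. C \<ge> 1 \<and>
         (\<forall>n\<ge>1. \<forall>U :: (nat \<Rightarrow> real) \<Rightarrow> (nat \<Rightarrow> real) \<Rightarrow> real.
            bilinear_form n U \<longrightarrow> mixed_sum a b n U \<le> C * form_norm p q n U))
      \<longleftrightarrow> admissible p q a b)
     \<and>
     ((\<exists>C::real. C \<ge> 1 \<and>
         (\<forall>n\<ge>1. \<forall>U :: (nat \<Rightarrow> complex) \<Rightarrow> (nat \<Rightarrow> complex) \<Rightarrow> complex.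
            bilinear_form n U \<longrightarrow> mixed_sum a b n U \<le> C * form_norm p q n U))
      \<longleftrightarrow> admissible p q a b)"
  using bounded_iff_admissible[OF assms, where 'k = real]
    bounded_iff_admissible[OF assms, where 'k = complex]
  by (rule conjI)

end
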